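(* Let $n\ge 1$ and $r\ge 1$ be integers. For every function $u:\mathbb{R}^n\to\mathbb{R}$ of class $C^r$ there is a unique polynomial $p\in\mathcal{S}_r$ such that $$D^\rho p(y_\beta)=D^\rho u(y_\beta)\qquad\text{for all }\beta\in\{0,1,2\}^n\text{ and all }\rho\in K_{r,\beta}.$$ Moreover, the polynomials $\phi_{\beta,\rho}\in\mathcal{S}_r$ ($\beta\in\{0,1,2\}^n$, $\rho\in K_{r,\beta}$) defined by $$D^{\rho'}\phi_{\beta,\rho}(y_{\beta'})=\delta_{\beta,\beta'}\,\delta_{\rho,\rho'}\qquad\text{for all }\beta'\in\{0,1,2\}^n,\ \rho'\in K_{r,\beta'}$$ form a basis of $\mathcal{S}_r$, and $$p(x)=\sum_{\beta\in\{0,1,2\}^n}\ \sum_{\rho\in K_{r,\beta}}D^\rho u(y_\beta)\,\phi_{\beta,\rho}(x).$$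
   Context: $\mathbb{N}_0=\{0,1,2,\ldots\}$. For $\alpha=(\alpha_1,\ldots,\alpha_n)\in\mathbb{N}_0^n$, $|\alpha|=\sum_{j=1}^n\alpha_j$, and the superlinear norm is $|\alpha|'=\sum_{j:\,\alpha_j\ge 2}\alpha_j$ (sum over those $j$ with $\alpha_j\ge2$). Define $S_r=\{\alpha\in\mathbb{N}_0^n: |\alpha|'\le r\}$. The serendipity space $\mathcal{S}_r$ is the real linear span of the monomials $x^\alpha=x_1^{\alpha_1}\cdots x_n^{\alpha_n}$ with $\alpha\in S_r$. For $\beta\in\{0,1,2\}^n$, the face $f_\beta$ of the cube $[-1,1]^n$ is the product $I_{1,\beta_1}\times\cdots\times I_{n,\beta_n}$ with $I_{j,0}=\{-1\}$, $I_{j,1}=\{1\}$, $I_{j,2}=(-1,1)$; its dimension is $d=\dim f_\beta=\#\{j:\beta_j=2\}$, and $y_\beta$ denotes its midpoint, i.e. $(y_\beta)_j=-1,1,0$ according as $\beta_j=0,1,2$. Define $K_{r,\beta}=\{\rho\in\mathbb{N}_0^n:|\rho|\le r-2\dim f_\beta,\ \rho_j=0\text{ whenever }\beta_j<2\}$ (empty if $r<2\dim f_\beta$). $D^\rho$ is the partial derivative $\partial^{|\rho|}/\partial x_1^{\rho_1}\cdots\partial x_n^{\rho_n}$. $\delta$ denotes the Kronecker delta. *)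

theory Defs
  imports "HOL-Analysis.Analysis" "HOL-Library.Function_Algebras"
begin

(* The pointwise real vector space of functions; together with the pointwise additive
   structure of Function_Algebras it makes span and independent available for functions. *)
instantiation "fun" :: (type, real_vector) real_vector
begin

definition scaleR_fun :: "real \<Rightarrow> ('a \<Rightarrow> 'b) \<Rightarrow> 'a \<Rightarrow> 'b" where
  "scaleR_fun c f = (\<lambda>x. c *\<^sub>R f x)"

instance
  by intro_classes
    (simp_all add: scaleR_fun_def fun_eq_iff scaleR_add_right scaleR_add_left)

end

(* Points of R^n are elements of real ^ 'n, where the index type 'n stands for {1,...,n}.
   Multi-indices, and the labels beta of faces, are functions 'n => nat. *)

definition multi_order :: "('n::finite \<Rightarrow> nat) \<Rightarrow> nat" where
  "multi_order \<alpha> = (\<Sum>j\<in>UNIV. \<alpha> j)"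

definition superlinear_norm :: "('n::finite \<Rightarrow> nat) \<Rightarrow> nat" where
  "superlinear_norm \<alpha> = (\<Sum>j | \<alpha> j \<ge> 2. \<alpha> j)"

definition monomial :: "('n::finite \<Rightarrow> nat) \<Rightarrow> real ^ 'n \<Rightarrow> real" where
  "monomial \<alpha> = (\<lambda>x. \<Prod>j\<in>UNIV. (x $ j) ^ \<alpha> j)"

definition superlinear_indices :: "nat \<Rightarrow> ('n::finite \<Rightarrow> nat) set" where
  "superlinear_indices r = {\<alpha>. superlinear_norm \<alpha> \<le> r}"

(* Real polynomials in n variables are identified with the polynomial functions on R^n. *)
definition serendipity :: "nat \<Rightarrow> (real ^ 'n::finite \<Rightarrow> real) set" where
  "serendipity r = span (monomial ` superlinear_indices r)"

definition partial :: "'n::finite \<Rightarrow> (real ^ 'n \<Rightarrow> real) \<Rightarrow> real ^ 'n \<Rightarrow> real" where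
  "partial i f = (\<lambda>x. deriv (\<lambda>t. f (x + t *\<^sub>R axis i 1)) 0)"

(* Class C^k: all iterated partial derivatives of order at most k exist everywhere
   and are continuous. *)
primrec C_class :: "nat \<Rightarrow> (real ^ 'n::finite \<Rightarrow> real) \<Rightarrow> bool" where
  "C_class 0 f \<longleftrightarrow> continuous_on UNIV f"
| "C_class (Suc k) f \<longleftrightarrow> continuous_on UNIV f \<and>
     (\<forall>i. (\<forall>x. (\<lambda>t. f (x + t *\<^sub>R axis i 1)) differentiable (at 0)) \<and>
          C_class k (partial i f))"

(* The linear order on 'n is used only to fix the order of differentiation: the
   derivatives in x_n are taken first, those in x_1 last. *)
definition multi_deriv ::
  "('n \<Rightarrow> nat) \<Rightarrow> (real ^ 'n::{finite,linorder} \<Rightarrow> real) \<Rightarrow> real ^ 'n::{finite,linorder} \<Rightarrow> real" where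
  "multi_deriv \<rho> f =
     foldr (\<lambda>i. partial i ^^ \<rho> i) (sorted_list_of_set UNIV) f"

definition face_labels :: "('n::finite \<Rightarrow> nat) set" where
  "face_labels = {\<beta>. \<forall>j. \<beta> j \<in> {0, 1, 2}}"

definition face_interval :: "nat \<Rightarrow> real set" where
  "face_interval b = (if b = 0 then {-1} else if b = 1 then {1} else {-1<..<1})"

definition face :: "('n::finite \<Rightarrow> nat) \<Rightarrow> (real ^ 'n) set" where
  "face \<beta> = {x. \<forall>j. x $ j \<in> face_interval (\<beta> j)}"

definition face_dim :: "('n::finite \<Rightarrow> nat) \<Rightarrow> nat" where
  "face_dim \<beta> = card {j. \<beta> j = 2}"

definition midpt :: "('n::finite \<Rightarrow> nat) \<Rightarrow> real ^ 'n" where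
  "midpt \<beta> = (\<chi> j. if \<beta> j = 0 then -1 else if \<beta> j = 1 then 1 else 0)"

lemma midpt_in_face: "midpt \<beta> \<in> face \<beta>"
  by (simp add: midpt_def face_def face_interval_def)

(* The subtraction takes place in the integers, so the set is empty if r < 2 * face_dim. *)
definition face_derivs :: "nat \<Rightarrow> ('n::finite \<Rightarrow> nat) \<Rightarrow> ('n \<Rightarrow> nat) set" where
  "face_derivs r \<beta> =
     {\<rho>. int (multi_order \<rho>) \<le> int r - 2 * int (face_dim \<beta>) \<and> (\<forall>j. \<beta> j < 2 \<longrightarrow> \<rho> j = 0)}"

definition interpolates ::
  "nat \<Rightarrow> (real ^ 'n::{finite,linorder} \<Rightarrow> real) \<Rightarrow> (real ^ 'n::{finite,linorder} \<Rightarrow> real) \<Rightarrow> bool" where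
  "interpolates r u p \<longleftrightarrow>
     (\<forall>\<beta>\<in>face_labels. \<forall>\<rho>\<in>face_derivs r \<beta>.
        multi_deriv \<rho> p (midpt \<beta>) = multi_deriv \<rho> u (midpt \<beta>))"

definition nodal ::
  "nat \<Rightarrow> ('n \<Rightarrow> nat) \<Rightarrow> ('n \<Rightarrow> nat) \<Rightarrow> (real ^ 'n::{finite,linorder} \<Rightarrow> real) \<Rightarrow> bool" where
  "nodal r \<beta> \<rho> f \<longleftrightarrow>
     f \<in> serendipity r \<and>
     (\<forall>\<beta>'\<in>face_labels. \<forall>\<rho>'\<in>face_derivs r \<beta>'.
        multi_deriv \<rho>' f (midpt \<beta>') = (if \<beta> = \<beta>' then 1 else 0) * (if \<rho> = \<rho>' then 1 else 0))"

end

(* The pair (beta, rho) is encoded by the multi-index beta + rho; this is a bijection from the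
   degrees of freedom onto S_r. Replace the monomial basis by the products of the univariate
   polynomials 1 - x, 1 + x, x^k (x^2 - 1): they span the same space because S_r is closed under
   lowering exponents and under replacing exponents 0 by 1. In one variable, evaluation at -1
   and at 1 and the k-th derivative at 0 (number k + 2) vanish on the basis polynomials of larger
   index but not on the one of equal index. Hence the interpolation matrix is triangular for the
   componentwise order on multi-indices, with nonzero diagonal. *)

theory Submission
  imports Defs "HOL-Computational_Algebra.Polynomial"
begin

section \<open>Linear maps on a subspace and triangular systems\<close>

text \<open>Linearity is asked for on \<open>W\<close> only: \<open>partial\<close> is built from
  \<open>deriv\<close>, whose value is unspecified where no derivative exists, so additivity is
  available only on functions known to be differentiable.\<close>

definition linear_map_on :: "'a::real_vector set \<Rightarrow> ('a \<Rightarrow> 'b::real_vector) \<Rightarrow> bool" where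
  "linear_map_on W T \<longleftrightarrow>
     (\<forall>f\<in>W. \<forall>g\<in>W. T (f + g) = T f + T g) \<and> (\<forall>c. \<forall>f\<in>W. T (c *\<^sub>R f) = c *\<^sub>R T f)"

lemma linear_map_onI:
  assumes "\<And>f g. f \<in> W \<Longrightarrow> g \<in> W \<Longrightarrow> T (f + g) = T f + T g"
    and "\<And>c f. f \<in> W \<Longrightarrow> T (c *\<^sub>R f) = c *\<^sub>R T f"
  shows "linear_map_on W T"
  using assms by (simp add: linear_map_on_def)

lemma linear_map_on_add:
  "linear_map_on W T \<Longrightarrow> f \<in> W \<Longrightarrow> g \<in> W \<Longrightarrow> T (f + g) = T f + T g"
  by (simp add: linear_map_on_def)

lemma linear_map_on_scaleR: "linear_map_on W T \<Longrightarrow> f \<in> W \<Longrightarrow> T (c *\<^sub>R f) = c *\<^sub>R T f"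
  by (simp add: linear_map_on_def)

lemma linear_map_on_zero:
  assumes "linear_map_on W T" "subspace W"
  shows "T 0 = 0"
  using linear_map_on_scaleR[OF assms(1) subspace_0[OF assms(2)], of 0] by simp

lemma linear_map_on_diff:
  assumes "linear_map_on W T" "subspace W" "f \<in> W" "g \<in> W"
  shows "T (f - g) = T f - T g"
  using linear_map_on_add[OF assms(1) subspace_diff[OF assms(2-4)] assms(4)] by simp

lemma linear_map_on_sum:
  assumes "linear_map_on W T" "subspace W" "\<And>i. i \<in> I \<Longrightarrow> f i \<in> W"
  shows "T (\<Sum>i\<in>I. c i *\<^sub>R f i) = (\<Sum>i\<in>I. c i *\<^sub>R T (f i))"
proof (cases "finite I")
  case True
  then show ?thesis using assms(3)
  proof (induction I)
    case empty
    then show ?case using linear_map_on_zero[OF assms(1,2)] by simp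
  next
    case (insert j I)
    have "c j *\<^sub>R f j \<in> W" "(\<Sum>i\<in>I. c i *\<^sub>R f i) \<in> W"
      using insert.prems assms(2) by (auto intro!: subspace_scale subspace_sum)
    then show ?case
      using insert by (simp add: linear_map_on_add[OF assms(1)] linear_map_on_scaleR[OF assms(1)])
  qed
qed (simp add: linear_map_on_zero[OF assms(1,2)])

lemma linear_map_on_comp:
  assumes "linear_map_on W T" "linear_map_on W S" "S ` W \<subseteq> W"
  shows "linear_map_on W (T \<circ> S)"
  using assms by (auto simp: linear_map_on_def image_subset_iff)

lemma linear_map_on_funpow:
  assumes "linear_map_on W T" "T ` W \<subseteq> W"
  shows "linear_map_on W (T ^^ k) \<and> (T ^^ k) ` W \<subseteq> W"
proof (induction k)
  case 0
  show ?case by (simp add: linear_map_on_def)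
next
  case (Suc k)
  then show ?case
    using linear_map_on_comp[OF assms(1), of "T ^^ k"] assms(2)
    by (auto simp: image_subset_iff comp_def)
qed

text \<open>Forward substitution: the indices are added in order of increasing rank
  \<open>\<mu>\<close>. The newest functional fixes the coefficient of the newest vector, and no
  earlier functional sees that vector. Solvability and uniqueness go through one induction.\<close>

lemma triangular_system_solvable:
  fixes \<psi> :: "'i \<Rightarrow> 'a::real_vector" and L :: "'i \<Rightarrow> 'a \<Rightarrow> real" and \<mu> :: "'i \<Rightarrow> nat"
  assumes "finite N" "subspace W"
    and lin: "\<And>\<nu>. \<nu> \<in> N \<Longrightarrow> linear_map_on W (L \<nu>)"
    and "\<psi> ` N \<subseteq> W"
    and "\<And>\<nu>. \<nu> \<in> N \<Longrightarrow> L \<nu> (\<psi> \<nu>) \<noteq> 0"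
    and "\<And>\<nu> \<kappa>. \<nu> \<in> N \<Longrightarrow> \<kappa> \<in> N \<Longrightarrow> L \<nu> (\<psi> \<kappa>) \<noteq> 0 \<Longrightarrow> \<kappa> = \<nu> \<or> \<mu> \<kappa> < \<mu> \<nu>"
  shows "\<exists>p\<in>span (\<psi> ` N). \<forall>\<nu>\<in>N. L \<nu> p = c \<nu>"
    and "p \<in> span (\<psi> ` N) \<Longrightarrow> (\<And>\<nu>. \<nu> \<in> N \<Longrightarrow> L \<nu> p = 0) \<Longrightarrow> p = 0"
proof -
  have "(\<exists>p\<in>span (\<psi> ` N). \<forall>\<nu>\<in>N. L \<nu> p = c \<nu>) \<and>
    (\<forall>p\<in>span (\<psi> ` N). (\<forall>\<nu>\<in>N. L \<nu> p = 0) \<longrightarrow> p = 0)"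
    using assms(1) lin assms(4-6)
  proof (induction N rule: finite_ranking_induct[where f = \<mu>])
    case empty
    show ?case by simp
  next
    case (insert m N)
    show ?case
    \<comment> \<open>The ranking induction does not guarantee that \<open>m\<close> is new.\<close>
    proof (cases "m \<in> N")
      case True
      then have "insert m N = N" by auto
      then show ?thesis using insert by auto
    next
      case False
      have lin': "\<And>\<nu>. \<nu> \<in> insert m N \<Longrightarrow> linear_map_on W (L \<nu>)"
        and diag: "L m (\<psi> m) \<noteq> 0" and mW: "\<psi> m \<in> W"
        using insert.prems by auto
      have IH: "\<exists>p\<in>span (\<psi> ` N). \<forall>\<nu>\<in>N. L \<nu> p = c \<nu>"
        "\<forall>p\<in>span (\<psi> ` N). (\<forall>\<nu>\<in>N. L \<nu> p = 0) \<longrightarrow> p = 0"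
        using insert.IH insert.prems by (auto 0 3)
      have spanW: "span (\<psi> ` N) \<subseteq> W"
        using insert.prems(2) assms(2) by (intro span_minimal) auto
      \<comment> \<open>\<open>m\<close> has maximal rank and lies outside \<open>N\<close>, so
        neither alternative of triangularity can hold for the pair \<open>\<nu>\<close>,
        \<open>m\<close>.\<close>
      have van: "L \<nu> (\<psi> m) = 0" if "\<nu> \<in> N" for \<nu>
        using insert.prems(4)[of \<nu> m] insert.hyps(2)[OF that] that False by force
      have val: "L \<nu> (q + k *\<^sub>R \<psi> m) = L \<nu> q + k * L \<nu> (\<psi> m)"
        if "\<nu> \<in> insert m N" "q \<in> span (\<psi> ` N)" for \<nu> q k
        using linear_map_on_add[OF lin'[OF that(1)], of q "k *\<^sub>R \<psi> m"]
          linear_map_on_scaleR[OF lin'[OF that(1)] mW] spanW that(2) mW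
          subspace_scale[OF assms(2) mW] by auto
      obtain q where q: "q \<in> span (\<psi> ` N)" "\<forall>\<nu>\<in>N. L \<nu> q = c \<nu>"
        using IH(1) by blast
      \<comment> \<open>The coefficient is chosen to make \<open>L m p\<close> equal to
        \<open>c m\<close>; by \<open>van\<close> the conditions already met on \<open>N\<close>
        survive.\<close>
      define p where "p = q + ((c m - L m q) / L m (\<psi> m)) *\<^sub>R \<psi> m"
      have "p \<in> span (\<psi> ` insert m N)"
        unfolding p_def
        by (intro span_add span_scale span_base subsetD[OF span_mono q(1)]) auto
      moreover have "\<forall>\<nu>\<in>insert m N. L \<nu> p = c \<nu>"
        using val[OF _ q(1)] q(2) van diag by (simp add: p_def)
      moreover have "p = 0"
        if p: "p \<in> span (\<psi> ` insert m N)" "\<forall>\<nu>\<in>insert m N. L \<nu> p = 0" for p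
      proof -
        \<comment> \<open>The functionals of \<open>N\<close> see only the component in the smaller
          span, which is therefore 0 by induction; then \<open>L m\<close> forces
          \<open>k = 0\<close>.\<close>
        obtain k where k: "p - k *\<^sub>R \<psi> m \<in> span (\<psi> ` N)"
          using p(1) span_breakdown_eq[of p "\<psi> m" "\<psi> ` N"] by auto
        have eq: "L \<nu> p = L \<nu> (p - k *\<^sub>R \<psi> m) + k * L \<nu> (\<psi> m)" if "\<nu> \<in> insert m N" for \<nu>
          using val[OF that k, of k] by simp
        have "\<forall>\<nu>\<in>N. L \<nu> (p - k *\<^sub>R \<psi> m) = 0"
        proof
          fix \<nu> assume "\<nu> \<in> N"
          then show "L \<nu> (p - k *\<^sub>R \<psi> m) = 0" using eq[of \<nu>] van p(2) by simp
        qed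
        then have 0: "p - k *\<^sub>R \<psi> m = 0" using IH(2) k by blast
        have "L m 0 = 0" using linear_map_on_zero[OF lin' assms(2)] by simp
        then have "k = 0" using eq[of m] 0 p(2) diag by simp
        then show ?thesis using 0 by simp
      qed
      ultimately show ?thesis by blast
    qed
  qed
  then show "\<exists>p\<in>span (\<psi> ` N). \<forall>\<nu>\<in>N. L \<nu> p = c \<nu>"
    and "p \<in> span (\<psi> ` N) \<Longrightarrow> (\<And>\<nu>. \<nu> \<in> N \<Longrightarrow> L \<nu> p = 0) \<Longrightarrow> p = 0"
    by blast+
qed

text \<open>\<open>L \<kappa>\<close> reads off the coefficient of \<open>\<phi> \<kappa>\<close> in
  a linear combination, which gives independence. Since the functionals separate the points of
  \<open>W\<close>, each \<open>p\<close> equals the combination with coefficients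
  \<open>L \<nu> p\<close>, which gives the span.\<close>

lemma dual_family_basis:
  fixes \<phi> :: "'i \<Rightarrow> 'a::real_vector" and L :: "'i \<Rightarrow> 'a \<Rightarrow> real"
  assumes "finite N" "subspace W"
    and lin: "\<And>\<nu>. \<nu> \<in> N \<Longrightarrow> linear_map_on W (L \<nu>)"
    and zero: "\<And>p. p \<in> W \<Longrightarrow> (\<And>\<nu>. \<nu> \<in> N \<Longrightarrow> L \<nu> p = 0) \<Longrightarrow> p = 0"
    and W: "\<And>\<nu>. \<nu> \<in> N \<Longrightarrow> \<phi> \<nu> \<in> W"
    and dual: "\<And>\<nu> \<kappa>. \<nu> \<in> N \<Longrightarrow> \<kappa> \<in> N \<Longrightarrow> L \<kappa> (\<phi> \<nu>) = (if \<nu> = \<kappa> then 1 else 0)"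
  shows "inj_on \<phi> N" and "independent (\<phi> ` N)" and "span (\<phi> ` N) = W"
    and "p \<in> W \<Longrightarrow> p = (\<Sum>\<nu>\<in>N. L \<nu> p *\<^sub>R \<phi> \<nu>)"
proof -
  have val: "L \<kappa> (\<Sum>\<nu>\<in>N. a \<nu> *\<^sub>R \<phi> \<nu>) = a \<kappa>" if "\<kappa> \<in> N" for \<kappa> a
  proof -
    have "L \<kappa> (\<Sum>\<nu>\<in>N. a \<nu> *\<^sub>R \<phi> \<nu>) = (\<Sum>\<nu>\<in>N. a \<nu> *\<^sub>R L \<kappa> (\<phi> \<nu>))"
      by (rule linear_map_on_sum[OF lin[OF that] assms(2) W])
    also have "\<dots> = (\<Sum>\<nu>\<in>N. if \<kappa> = \<nu> then a \<nu> else 0)"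
      by (intro sum.cong) (auto simp: dual that)
    also have "\<dots> = a \<kappa>" using that assms(1) by simp
    finally show ?thesis .
  qed
  show inj: "inj_on \<phi> N"
    by (rule inj_onI) (metis dual zero_neq_one)
  show "independent (\<phi> ` N)"
  proof (rule independent_if_scalars_zero)
    show "finite (\<phi> ` N)" using assms(1) by simp
    fix f x assume "(\<Sum>x\<in>\<phi> ` N. f x *\<^sub>R x) = 0" and x: "x \<in> \<phi> ` N"
    then have *: "(\<Sum>\<nu>\<in>N. f (\<phi> \<nu>) *\<^sub>R \<phi> \<nu>) = 0" by (simp add: sum.reindex[OF inj])
    from x obtain \<kappa> where \<kappa>: "\<kappa> \<in> N" "x = \<phi> \<kappa>" by blast
    have "L \<kappa> 0 = 0" by (rule linear_map_on_zero[OF lin[OF \<kappa>(1)] assms(2)])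
    then show "f x = 0" using val[OF \<kappa>(1), of "\<lambda>\<nu>. f (\<phi> \<nu>)"] * \<kappa>(2) by simp
  qed
  show expand: "p = (\<Sum>\<nu>\<in>N. L \<nu> p *\<^sub>R \<phi> \<nu>)" if p: "p \<in> W" for p
  proof -
    have s: "(\<Sum>\<nu>\<in>N. L \<nu> p *\<^sub>R \<phi> \<nu>) \<in> W"
      using W assms(2) by (auto intro!: subspace_sum subspace_scale)
    \<comment> \<open>By \<open>val\<close> every functional takes the same value on
      \<open>p\<close> and on the sum, so \<open>zero\<close> applies to the difference.\<close>
    have "p - (\<Sum>\<nu>\<in>N. L \<nu> p *\<^sub>R \<phi> \<nu>) = 0"
      using p s val by (intro zero subspace_diff[OF assms(2)])
        (simp_all add: linear_map_on_diff[OF lin assms(2)])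
    then show ?thesis by simp
  qed
  show "span (\<phi> ` N) = W"
  proof
    show "span (\<phi> ` N) \<subseteq> W" using W assms(2) by (intro span_minimal) auto
    show "W \<subseteq> span (\<phi> ` N)"
    proof
      fix p assume "p \<in> W"
      then show "p \<in> span (\<phi> ` N)"
        by (subst expand) (auto intro: span_sum span_scale span_base)
    qed
  qed
qed

section \<open>Derivatives of products of univariate polynomials\<close>

lemma sum_fun_apply: "(\<Sum>i\<in>I. f i) x = (\<Sum>i\<in>I. f i x)"
  by (induction I rule: infinite_finite_induct) auto

lemma scaleR_fun_apply: "(c *\<^sub>R f) x = c *\<^sub>R f x"
  by (simp add: scaleR_fun_def)

text \<open>Keeping the univariate factors separate lets partial derivatives act through
  \<open>pderiv\<close> on one factor. Both monomials and the hierarchical basis have this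
  form.\<close>

definition poly_product :: "('n::finite \<Rightarrow> real poly) \<Rightarrow> real ^ 'n \<Rightarrow> real" where
  "poly_product P = (\<lambda>x. \<Prod>j\<in>UNIV. poly (P j) (x $ j))"

lemma poly_product_has_partial:
  "((\<lambda>t. poly_product P (x + t *\<^sub>R axis i 1)) has_field_derivative
     poly_product (P(i := pderiv (P i))) x) (at 0)"
proof -
  define C where "C = (\<Prod>j\<in>UNIV - {i}. poly (P j) (x $ j))"
  \<comment> \<open>Only factor \<open>i\<close> depends on \<open>t\<close>. The polynomial
    \<open>Q\<close> is left free so that the identity serves both the function and, at
    \<open>t = 0\<close>, its derivative.\<close>
  have split: "poly_product (P(i := Q)) (x + t *\<^sub>R axis i 1) = poly Q (x $ i + t) * C" for Q t
    unfolding poly_product_def C_def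
    by (subst prod.remove[of _ i]) (auto simp: axis_def intro!: prod.cong)
  have "((\<lambda>t. poly (P i) (x $ i + t) * C) has_field_derivative poly (pderiv (P i)) (x $ i) * C) (at 0)"
    by (auto intro!: derivative_eq_intros)
  then show ?thesis
    using split[of "P i"] split[of "pderiv (P i)" 0] by simp
qed

abbreviation polynomial_functions :: "(real ^ 'n::finite \<Rightarrow> real) set" where
  "polynomial_functions \<equiv> span (range poly_product)"

text \<open>A value of \<open>partial\<close> says nothing about differentiability, so the existence
  of the derivative is established along with the stability of the space.\<close>

lemma polynomial_function_partial:
  assumes "f \<in> polynomial_functions"
  shows "((\<lambda>t. f (x + t *\<^sub>R axis i 1)) has_field_derivative partial i f x) (at 0)"
    and "partial i f \<in> polynomial_functions"
proof -
  \<comment> \<open>The induction carries an explicit derivative \<open>g\<close> instead of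
    \<open>partial i f\<close>, since linearity of \<open>partial\<close> is not yet known.
    Uniqueness of derivatives identifies the two afterwards.\<close>
  have "\<exists>g\<in>polynomial_functions. \<forall>x. ((\<lambda>t. f (x + t *\<^sub>R axis i 1)) has_field_derivative g x) (at 0)"
    using assms
  proof (induction rule: span_induct_alt)
    case base
    show ?case by (rule bexI[of _ 0]) (auto intro: span_zero)
  next
    case (step c h f)
    then obtain P g where "h = poly_product P" "g \<in> polynomial_functions"
      and g: "\<And>x. ((\<lambda>t. f (x + t *\<^sub>R axis i 1)) has_field_derivative g x) (at 0)" by auto
    let ?g = "c *\<^sub>R poly_product (P(i := pderiv (P i))) + g"
    have "?g \<in> polynomial_functions"
      by (intro span_add span_scale span_base rangeI \<open>g \<in> polynomial_functions\<close>)
    moreover have "((\<lambda>t. (c *\<^sub>R h + f) (x + t *\<^sub>R axis i 1)) has_field_derivative ?g x) (at 0)" for x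
      unfolding plus_fun_apply scaleR_fun_apply real_scaleR_def \<open>h = poly_product P\<close>
      by (intro DERIV_add DERIV_cmult poly_product_has_partial g)
    ultimately show ?case by blast
  qed
  then obtain g where g: "g \<in> polynomial_functions"
    "\<And>x. ((\<lambda>t. f (x + t *\<^sub>R axis i 1)) has_field_derivative g x) (at 0)" by blast
  have "partial i f = g"
    using g(2) by (auto simp: partial_def intro!: DERIV_imp_deriv)
  with g show "((\<lambda>t. f (x + t *\<^sub>R axis i 1)) has_field_derivative partial i f x) (at 0)"
    and "partial i f \<in> polynomial_functions"
    by auto
qed

lemma partial_linear_on_polynomial_functions:
  fixes i :: "'n::finite"
  shows "linear_map_on polynomial_functions (partial i)"
proof (rule linear_map_onI)
  fix f g :: "real ^ 'n \<Rightarrow> real"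
  assume "f \<in> polynomial_functions" "g \<in> polynomial_functions"
  then show "partial i (f + g) = partial i f + partial i g"
    by (auto simp: partial_def[of i "f + g"] fun_eq_iff
        intro!: DERIV_imp_deriv DERIV_add polynomial_function_partial(1))
next
  fix c and f :: "real ^ 'n \<Rightarrow> real"
  assume "f \<in> polynomial_functions"
  then show "partial i (c *\<^sub>R f) = c *\<^sub>R partial i f"
    by (auto simp: partial_def[of i "c *\<^sub>R f"] scaleR_fun_apply fun_eq_iff
        intro!: DERIV_imp_deriv DERIV_cmult polynomial_function_partial(1))
qed

lemma multi_deriv_linear_on_polynomial_functions:
  fixes \<rho> :: "'n::{finite,linorder} \<Rightarrow> nat"
  shows "linear_map_on polynomial_functions (multi_deriv \<rho>)"
proof -
  have pow: "linear_map_on polynomial_functions (partial i ^^ k) \<and>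
      (partial i ^^ k) ` polynomial_functions \<subseteq> polynomial_functions" for i :: 'n and k
    by (rule linear_map_on_funpow[OF partial_linear_on_polynomial_functions])
      (auto intro: polynomial_function_partial(2))
  \<comment> \<open>Generalised to arbitrary lists of variables. Stability of the space is carried
    along because linearity of a composition needs it.\<close>
  have "linear_map_on polynomial_functions (foldr (\<lambda>i. partial i ^^ \<rho> i) xs) \<and>
      foldr (\<lambda>i. partial i ^^ \<rho> i) xs ` polynomial_functions \<subseteq> polynomial_functions" for xs
  proof (induction xs)
    case Nil
    show ?case by (simp add: linear_map_on_def)
  next
    case (Cons i xs)
    show ?case
      using Cons linear_map_on_comp[OF conjunct1[OF pow[where i = i and k = "\<rho> i"]], of "foldr (\<lambda>i. partial i ^^ \<rho> i) xs"]
        conjunct2[OF pow[where i = i and k = "\<rho> i"]] by (auto simp: image_subset_iff comp_def)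
  qed
  then show ?thesis by (simp add: multi_deriv_def[abs_def])
qed

lemma partial_poly_product: "partial i (poly_product P) = poly_product (P(i := pderiv (P i)))"
  by (auto simp: partial_def intro!: DERIV_imp_deriv poly_product_has_partial)

lemma partial_funpow_poly_product:
  "(partial i ^^ k) (poly_product P) = poly_product (P(i := (pderiv ^^ k) (P i)))"
  by (induction k) (simp_all only: funpow.simps o_apply id_apply partial_poly_product fun_upd_triv
      fun_upd_upd fun_upd_same)

lemma multi_deriv_poly_product:
  "multi_deriv \<rho> (poly_product P) = poly_product (\<lambda>j. (pderiv ^^ \<rho> j) (P j))"
proof -
  \<comment> \<open>For a partial list the remaining factors are still undifferentiated;
    distinctness ensures that no variable is treated twice.\<close>
  have "foldr (\<lambda>i. partial i ^^ \<rho> i) xs (poly_product P) =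
      poly_product (\<lambda>j. if j \<in> set xs then (pderiv ^^ \<rho> j) (P j) else P j)"
    if "distinct xs" for xs
    using that
  proof (induction xs)
    case (Cons i xs)
    then show ?case
      by (auto simp: partial_funpow_poly_product intro!: arg_cong[of _ _ poly_product])
  qed simp
  then show ?thesis by (simp add: multi_deriv_def)
qed

section \<open>A hierarchical basis of the serendipity space\<close>

text \<open>Indices 0 and 1 give, up to the factor 2, the linear Lagrange polynomials of the
  endpoints -1 and 1. Index \<open>k + 2\<close> gives a bubble that vanishes at both endpoints and
  has lowest power \<open>x^k\<close>.\<close>

fun hier :: "nat \<Rightarrow> real poly" where
  "hier 0 = [:1, -1:]"
| "hier (Suc 0) = [:1, 1:]"
| "hier (Suc (Suc k)) = Polynomial.monom 1 k * [:-1, 0, 1:]"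

lemma monomial_eq_poly_product: "monomial \<alpha> = poly_product (\<lambda>j. Polynomial.monom 1 (\<alpha> j))"
  by (simp add: monomial_def poly_product_def poly_monom)

text \<open>Only exponents of at least 2 count in the norm, and wherever \<open>\<gamma> j\<close>
  is that large the bound forces \<open>\<gamma> j \<le> \<alpha> j\<close>.\<close>

lemma superlinear_indices_mono:
  assumes "\<alpha> \<in> superlinear_indices r" "\<And>j. \<gamma> j \<le> max (\<alpha> j) 1"
  shows "\<gamma> \<in> superlinear_indices r"
proof -
  have "superlinear_norm \<gamma> \<le> superlinear_norm \<alpha>"
    unfolding superlinear_norm_def
  proof (rule order_trans[OF sum_mono sum_mono2])
    show "{j. 2 \<le> \<gamma> j} \<subseteq> {j. 2 \<le> \<alpha> j}"
    proof clarify
      fix j assume "2 \<le> \<gamma> j" then show "2 \<le> \<alpha> j" using assms(2)[of j] by linarith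
    qed
    show "\<gamma> j \<le> \<alpha> j" if "j \<in> {j. 2 \<le> \<gamma> j}" for j
      using that assms(2)[of j] by (auto simp: max_def split: if_splits)
  qed auto
  then show ?thesis using assms(1) by (simp add: superlinear_indices_def)
qed

text \<open>Expansions may use all degrees up to \<open>max k 1\<close>, because replacing a factor of degree 0 by one
  of degree 1 does not increase the superlinear norm.\<close>
lemma poly_product_span_change:
  fixes f g :: "nat \<Rightarrow> real poly"
  assumes "\<And>k. poly (f k) \<in> span ((\<lambda>b. poly (g b)) ` {..max k 1})"
    and \<alpha>: "\<alpha> \<in> superlinear_indices r"
  shows "poly_product (\<lambda>j. f (\<alpha> j)) \<in> span ((\<lambda>\<gamma>. poly_product (\<lambda>j. g (\<gamma> j))) ` superlinear_indices r)"
proof -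
  \<comment> \<open>Membership in the span is turned into coefficients independent of
    \<open>x\<close>, as needed for multiplying out the product.\<close>
  have "\<exists>c. \<forall>x. poly (f k) x = (\<Sum>b\<le>max k 1. c b * poly (g b) x)" for k
  proof -
    have sp: "p \<in> span ((\<lambda>b. poly (g b)) ` {..m}) \<Longrightarrow> \<exists>c. \<forall>x. p x = (\<Sum>b\<le>m. c b * poly (g b) x)" for p m
    proof (induction rule: span_induct_alt)
      case base
      show ?case by (rule exI[of _ "\<lambda>_. 0"]) simp
    next
      case (step a q p)
      then obtain i c where i: "i \<le> m" "q = poly (g i)" and c: "\<And>x. p x = (\<Sum>b\<le>m. c b * poly (g b) x)"
        by auto
      show ?case
      proof (rule exI[of _ "\<lambda>b. (if b = i then a else 0) + c b"], rule allI)
        fix x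
        have "(\<Sum>b\<le>m. (if b = i then a else 0) * poly (g b) x) =
            (\<Sum>b\<le>m. if i = b then a * poly (g b) x else 0)"
          by (intro sum.cong) auto
        then show "(a *\<^sub>R q + p) x = (\<Sum>b\<le>m. ((if b = i then a else 0) + c b) * poly (g b) x)"
          using i by (simp add: c sum.distrib distrib_right scaleR_fun_apply)
      qed
    qed
    then show ?thesis using assms(1) by blast
  qed
  then obtain c where c: "\<And>k x. poly (f k) x = (\<Sum>b\<le>max k 1. c k b * poly (g b) x)"
    by metis
  let ?B = "\<lambda>j. {..max (\<alpha> j) 1}"
  have "poly_product (\<lambda>j. f (\<alpha> j)) =
    (\<Sum>\<gamma>\<in>Pi\<^sub>E UNIV ?B. (\<Prod>j\<in>UNIV. c (\<alpha> j) (\<gamma> j)) *\<^sub>R poly_product (\<lambda>j. g (\<gamma> j)))"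
  proof
    fix x
    have "poly_product (\<lambda>j. f (\<alpha> j)) x =
        (\<Prod>j\<in>UNIV. \<Sum>b\<in>?B j. c (\<alpha> j) b * poly (g b) (x $ j))"
      by (simp add: poly_product_def c)
    \<comment> \<open>Distributivity: one term for each choice \<open>\<gamma>\<close> of a summand
      in every variable.\<close>
    also have "\<dots> = (\<Sum>\<gamma>\<in>Pi\<^sub>E UNIV ?B. \<Prod>j\<in>UNIV. c (\<alpha> j) (\<gamma> j) * poly (g (\<gamma> j)) (x $ j))"
      by (rule prod_sum_PiE) auto
    finally show "poly_product (\<lambda>j. f (\<alpha> j)) x =
      (\<Sum>\<gamma>\<in>Pi\<^sub>E UNIV ?B. (\<Prod>j\<in>UNIV. c (\<alpha> j) (\<gamma> j)) *\<^sub>R poly_product (\<lambda>j. g (\<gamma> j))) x"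
      by (simp add: sum_fun_apply scaleR_fun_apply poly_product_def prod.distrib)
  qed
  also have "\<dots> \<in> span ((\<lambda>\<gamma>. poly_product (\<lambda>j. g (\<gamma> j))) ` superlinear_indices r)"
    by (intro span_sum span_scale span_base imageI superlinear_indices_mono[OF \<alpha>])
      (auto simp: PiE_UNIV_domain)
  finally show ?thesis .
qed

text \<open>The last case is \<open>x^(m+2) - x^m\<close>. The bound \<open>max k 1\<close> is
  needed at \<open>k = 0\<close>, where \<open>1 - x\<close> has degree 1.\<close>

lemma hier_in_span_monom:
  "poly (hier k) \<in> span ((\<lambda>b. poly (Polynomial.monom 1 b)) ` {..max k 1})" (is "_ \<in> span (?m ` _)")
proof (cases k rule: hier.cases)
  case 1
  have "poly (hier k) = ?m 0 - ?m 1"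
    by (auto simp: 1 poly_monom)
  moreover have "\<dots> \<in> span (?m ` {..max k 1})"
    by (intro span_diff span_base imageI) auto
  ultimately show ?thesis by metis
next
  case 2
  have "poly (hier k) = ?m 0 + ?m 1"
    by (auto simp: 2 poly_monom)
  moreover have "\<dots> \<in> span (?m ` {..max k 1})"
    by (intro span_add span_base imageI) auto
  ultimately show ?thesis by metis
next
  case (3 m)
  have "poly (hier k) = ?m (Suc (Suc m)) - ?m m"
    by (auto simp: 3 poly_monom algebra_simps)
  moreover have "\<dots> \<in> span (?m ` {..max k 1})"
    by (intro span_diff span_base imageI) (auto simp: 3)
  ultimately show ?thesis by metis
qed

text \<open>1 and \<open>x\<close> are half the sum and half the difference of \<open>1 + x\<close>
  and \<open>1 - x\<close>. From there \<open>x^(k+2) = x^k (x^2 - 1) + x^k\<close> lowers the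
  exponent by two.\<close>

lemma monom_in_span_hier:
  "poly (Polynomial.monom 1 k) \<in> span ((\<lambda>b. poly (hier b)) ` {..max k 1})" (is "_ \<in> span (?h ` _)")
proof (induction k rule: induct_nat_012[case_names 0 1 ge2])
  case 0
  have "poly (Polynomial.monom 1 0) = (1/2) *\<^sub>R ?h 0 + (1/2) *\<^sub>R ?h (Suc 0)"
    by (auto simp: poly_monom scaleR_fun_apply field_simps)
  moreover have "\<dots> \<in> span (?h ` {..max 0 1})"
    by (intro span_add span_scale span_base imageI) auto
  ultimately show ?case by metis
next
  case 1
  have "poly (Polynomial.monom 1 (Suc 0)) = (1/2) *\<^sub>R ?h (Suc 0) - (1/2) *\<^sub>R ?h 0"
    by (auto simp: poly_monom scaleR_fun_apply field_simps)
  moreover have "\<dots> \<in> span (?h ` {..max (Suc 0) 1})"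
    by (intro span_diff span_scale span_base imageI) auto
  ultimately show ?case by metis
next
  case (ge2 k)
  have "poly (Polynomial.monom 1 (Suc (Suc k))) = ?h (Suc (Suc k)) + poly (Polynomial.monom 1 k)"
    by (auto simp: poly_monom algebra_simps)
  moreover have "?h (Suc (Suc k)) \<in> span (?h ` {..max (Suc (Suc k)) 1})"
    by (intro span_base imageI) auto
  moreover have "span (?h ` {..max k 1}) \<subseteq> span (?h ` {..max (Suc (Suc k)) 1})"
    by (intro span_mono image_mono) auto
  then have "poly (Polynomial.monom 1 k) \<in> span (?h ` {..max (Suc (Suc k)) 1})"
    using ge2(1) by (rule subsetD)
  ultimately show ?case by (simp only: span_add)
qed

text \<open>Each univariate family expands in the other within the bound \<open>max k 1\<close>, so
  each product family lies in the span of the other.\<close>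

lemma serendipity_eq_span_hier:
  "serendipity r = span ((\<lambda>\<gamma>. poly_product (\<lambda>j. hier (\<gamma> j))) ` superlinear_indices r)"
  unfolding serendipity_def span_eq monomial_eq_poly_product[abs_def]
  using poly_product_span_change[OF monom_in_span_hier] poly_product_span_change[OF hier_in_span_monom]
  by blast

lemma serendipity_subset_polynomial_functions: "serendipity r \<subseteq> polynomial_functions"
  unfolding serendipity_def by (intro span_mono) (auto simp: monomial_eq_poly_product)

section \<open>Unisolvence of the degrees of freedom\<close>

abbreviation dofs :: "nat \<Rightarrow> (('n::finite \<Rightarrow> nat) \<times> ('n \<Rightarrow> nat)) set" where
  "dofs r \<equiv> Sigma face_labels (face_derivs r)"

definition dof_index :: "('n \<Rightarrow> nat) \<times> ('n \<Rightarrow> nat) \<Rightarrow> 'n \<Rightarrow> nat" where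
  "dof_index = (\<lambda>(\<beta>, \<rho>) j. \<beta> j + \<rho> j)"

definition dof ::
  "('n \<Rightarrow> nat) \<times> ('n \<Rightarrow> nat) \<Rightarrow> (real ^ 'n::{finite,linorder} \<Rightarrow> real) \<Rightarrow> real" where
  "dof = (\<lambda>(\<beta>, \<rho>) f. multi_deriv \<rho> f (midpt \<beta>))"

text \<open>The coordinates counted by the norm are exactly the free directions of the face, each
  contributing \<open>2 + \<rho> j\<close>. Thus the order bound in \<open>face_derivs\<close>
  becomes the bound \<open>r\<close> on the superlinear norm.\<close>

lemma superlinear_norm_dof_index:
  assumes "\<beta> \<in> face_labels" "\<And>j. \<beta> j < 2 \<Longrightarrow> \<rho> j = 0"
  shows "superlinear_norm (dof_index (\<beta>, \<rho>)) = 2 * face_dim \<beta> + multi_order \<rho>"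
proof -
  have b: "\<beta> j = 0 \<or> \<beta> j = 1 \<or> \<beta> j = 2" for j using assms(1) by (auto simp: face_labels_def)
  have eq: "{j. 2 \<le> \<beta> j + \<rho> j} = {j. \<beta> j = 2}"
  proof (rule Collect_cong)
    fix j show "2 \<le> \<beta> j + \<rho> j \<longleftrightarrow> \<beta> j = 2" using b[of j] assms(2)[of j] by auto
  qed
  have "superlinear_norm (dof_index (\<beta>, \<rho>)) = (\<Sum>j | \<beta> j = 2. 2 + \<rho> j)"
    by (simp add: superlinear_norm_def dof_index_def eq)
  also have "\<dots> = 2 * face_dim \<beta> + (\<Sum>j | \<beta> j = 2. \<rho> j)"
    by (simp only: sum.distrib face_dim_def sum_constant) simp
  also have "(\<Sum>j | \<beta> j = 2. \<rho> j) = multi_order \<rho>"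
    unfolding multi_order_def
  proof (rule sum.mono_neutral_left)
    show "\<forall>j\<in>UNIV - {j. \<beta> j = 2}. \<rho> j = 0"
    proof
      fix j assume "j \<in> UNIV - {j. \<beta> j = 2}"
      then show "\<rho> j = 0" using b[of j] assms(2)[of j] by auto
    qed
  qed auto
  finally show ?thesis .
qed

lemma dof_index_image:
  "dof_index ` dofs r = (superlinear_indices r :: ('n::finite \<Rightarrow> nat) set)" (is "?A = ?B")
proof
  show "?A \<subseteq> ?B"
    using superlinear_norm_dof_index
    by (fastforce simp: superlinear_indices_def face_derivs_def)
  show "?B \<subseteq> ?A"
  proof
    fix \<alpha> :: "'n \<Rightarrow> nat" assume \<alpha>: "\<alpha> \<in> superlinear_indices r"
    \<comment> \<open>The inverse of the encoding; truncated subtraction makes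
      \<open>\<rho> j\<close> vanish wherever \<open>\<beta> j < 2\<close>.\<close>
    define \<beta> \<rho> where "\<beta> = (\<lambda>j. min (\<alpha> j) 2)" and "\<rho> = (\<lambda>j. \<alpha> j - 2)"
    have eq: "dof_index (\<beta>, \<rho>) = \<alpha>" by (auto simp: dof_index_def \<beta>_def \<rho>_def)
    have \<beta>: "\<beta> \<in> face_labels" by (auto simp: face_labels_def \<beta>_def)
    have \<rho>: "\<beta> j < 2 \<Longrightarrow> \<rho> j = 0" for j by (auto simp: \<beta>_def \<rho>_def)
    have "superlinear_norm \<alpha> = 2 * face_dim \<beta> + multi_order \<rho>"
      unfolding eq[symmetric] by (rule superlinear_norm_dof_index) (use \<beta> \<rho> in auto)
    then have "\<rho> \<in> face_derivs r \<beta>"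
      using \<alpha> \<rho> by (auto simp: face_derivs_def superlinear_indices_def)
    then show "\<alpha> \<in> ?A" using \<beta> eq by (intro image_eqI[of _ _ "(\<beta>, \<rho>)"]) auto
  qed
qed

text \<open>In each coordinate a sum below 2 is \<open>\<beta> j\<close> itself, with
  \<open>\<rho> j = 0\<close>; a sum of at least 2 means \<open>\<beta> j = 2\<close>, and
  \<open>\<rho> j\<close> is the excess.\<close>

lemma inj_on_dof_index: "inj_on dof_index (dofs r)"
proof (rule inj_onI, clarify)
  fix \<beta> \<rho> \<beta>' \<rho>' :: "'a \<Rightarrow> nat"
  assume *: "\<beta> \<in> face_labels" "\<rho> \<in> face_derivs r \<beta>" "\<beta>' \<in> face_labels" "\<rho>' \<in> face_derivs r \<beta>'"
    and eq: "dof_index (\<beta>, \<rho>) = dof_index (\<beta>', \<rho>')"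
  have "\<beta> j = \<beta>' j \<and> \<rho> j = \<rho>' j" for j
  proof -
    have "\<beta> j = 0 \<or> \<beta> j = 1 \<or> \<beta> j = 2" "\<beta>' j = 0 \<or> \<beta>' j = 1 \<or> \<beta>' j = 2"
      "\<beta> j < 2 \<longrightarrow> \<rho> j = 0" "\<beta>' j < 2 \<longrightarrow> \<rho>' j = 0"
      using * by (auto simp: face_labels_def face_derivs_def)
    then show ?thesis using fun_cong[OF eq, of j] by (auto simp: dof_index_def)
  qed
  then show "\<beta> = \<beta>' \<and> \<rho> = \<rho>'" by auto
qed

section \<open>Finiteness of the set of degrees of freedom\<close>

lemma finite_bounded_functions: "finite {f :: 'n::finite \<Rightarrow> nat. \<forall>j. f j \<le> m}"
proof -
  have "{f :: 'n \<Rightarrow> nat. \<forall>j. f j \<le> m} = Pi\<^sub>E UNIV (\<lambda>_. {..m})" by (auto simp: PiE_UNIV_domain)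
  then show ?thesis by (simp add: finite_PiE)
qed

lemma finite_face_labels: "finite (face_labels :: ('n::finite \<Rightarrow> nat) set)"
proof (rule finite_subset[OF _ finite_bounded_functions[of 2]], clarify)
  fix \<beta> :: "'n \<Rightarrow> nat" and j
  assume "\<beta> \<in> face_labels"
  then have "\<beta> j \<in> {0, 1, 2}" by (simp add: face_labels_def)
  then show "\<beta> j \<le> 2" by auto
qed

lemma finite_face_derivs: "finite (face_derivs r (\<beta> :: 'n::finite \<Rightarrow> nat))"
proof (rule finite_subset[OF _ finite_bounded_functions[of r]], clarify)
  fix \<rho> :: "'n \<Rightarrow> nat" and j assume "\<rho> \<in> face_derivs r \<beta>"
  then have "multi_order \<rho> \<le> r" by (simp add: face_derivs_def)
  moreover have "\<rho> j \<le> multi_order \<rho>" unfolding multi_order_def by (rule member_le_sum) auto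
  ultimately show "\<rho> j \<le> r" by simp
qed

section \<open>Triangularity on the hierarchical basis\<close>

lemma poly_higher_pderiv_0: "poly ((pderiv ^^ k) p) 0 = fact k * coeff (p :: real poly) k"
  by (simp add: poly_0_coeff_0 coeff_higher_pderiv pochhammer_fact)

lemma hier_functional_triangular:
  assumes "b \<in> {0, 1, 2::nat}" "b < 2 \<Longrightarrow> k = 0"
    and "y = (if b = 0 then -1 else if b = 1 then 1 else (0::real))"
  shows "poly ((pderiv ^^ k) (hier a)) y \<noteq> 0 \<Longrightarrow> a \<le> b + k"
    and "poly ((pderiv ^^ k) (hier (b + k))) y \<noteq> 0"
proof -
  consider "b = 0" "k = 0" "y = -1" | "b = 1" "k = 0" "y = 1" | "b = 2" "y = 0"
    using assms by auto
  then show "a \<le> b + k" if "poly ((pderiv ^^ k) (hier a)) y \<noteq> 0"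
  proof cases
    case 1
    then show ?thesis using that by (cases a rule: hier.cases) auto
  next
    case 2
    then show ?thesis using that by (cases a rule: hier.cases) auto
  next
    \<comment> \<open>The derivative at 0 reads off the coefficient of \<open>x^k\<close>. A bubble
      of index \<open>m + 2\<close> has none below \<open>x^m\<close>, so a nonzero value requires
      \<open>m \<le> k\<close>.\<close>
    case 3
    then show ?thesis using that
      by (cases a rule: hier.cases)
        (auto simp: poly_higher_pderiv_0 coeff_monom_mult simp del: mult_pCons_right split: if_splits)
  qed
  show "poly ((pderiv ^^ k) (hier (b + k))) y \<noteq> 0"
    using assms by (auto simp: poly_higher_pderiv_0 coeff_monom_mult simp del: mult_pCons_right)
qed

lemma dof_hier:
  "dof (\<beta>, \<rho>) (poly_product (\<lambda>j. hier (\<gamma> j))) =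
     (\<Prod>j\<in>UNIV. poly ((pderiv ^^ \<rho> j) (hier (\<gamma> j))) (midpt \<beta> $ j))"
  by (simp add: dof_def multi_deriv_poly_product) (simp add: poly_product_def)

text \<open>A degree of freedom factorises over the coordinates, and a product is nonzero exactly
  when all factors are, so the univariate statement yields a componentwise bound.\<close>

lemma dof_hier_triangular:
  fixes \<nu> :: "('n::{finite,linorder} \<Rightarrow> nat) \<times> ('n \<Rightarrow> nat)"
  assumes "\<nu> \<in> dofs r"
  shows "dof \<nu> (poly_product (\<lambda>j. hier (\<gamma> j))) \<noteq> 0 \<Longrightarrow> \<gamma> j \<le> dof_index \<nu> j"
    and "dof \<nu> (poly_product (\<lambda>j. hier (dof_index \<nu> j))) \<noteq> 0"
proof -
  obtain \<beta> \<rho> where \<nu>: "\<nu> = (\<beta>, \<rho>)" by (cases \<nu>)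
  have b: "\<beta> j \<in> {0, 1, 2}" "\<beta> j < 2 \<Longrightarrow> \<rho> j = 0"
    "midpt \<beta> $ j = (if \<beta> j = 0 then -1 else if \<beta> j = 1 then 1 else 0)" for j
    using assms by (auto simp: \<nu> face_labels_def face_derivs_def midpt_def)
  note tri = hier_functional_triangular[OF b]
  show "\<gamma> j \<le> dof_index \<nu> j" if "dof \<nu> (poly_product (\<lambda>j. hier (\<gamma> j))) \<noteq> 0"
    using that tri(1)[of j] by (simp add: \<nu> dof_hier dof_index_def)
  show "dof \<nu> (poly_product (\<lambda>j. hier (dof_index \<nu> j))) \<noteq> 0"
    using tri(2) by (simp add: \<nu> dof_hier dof_index_def)
qed

section \<open>Linearity of the degrees of freedom and unisolvence\<close>

lemma dof_linear_on_serendipity: "linear_map_on (serendipity r) (dof \<nu>)"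
proof (rule linear_map_onI)
  have V: "f \<in> polynomial_functions" if "f \<in> serendipity r" for f :: "real ^ 'a::{finite,linorder} \<Rightarrow> real"
    using that serendipity_subset_polynomial_functions by blast
  note lin = multi_deriv_linear_on_polynomial_functions
  show "dof \<nu> (f + g) = dof \<nu> f + dof \<nu> g" if "f \<in> serendipity r" "g \<in> serendipity r" for f g
    using linear_map_on_add[OF lin V[OF that(1)] V[OF that(2)]] by (cases \<nu>) (simp add: dof_def)
  show "dof \<nu> (c *\<^sub>R f) = c *\<^sub>R dof \<nu> f" if "f \<in> serendipity r" for c f
    using linear_map_on_scaleR[OF lin V[OF that]] by (cases \<nu>) (simp add: dof_def scaleR_fun_apply)
qed

lemma subspace_serendipity: "subspace (serendipity r)"
  by (simp add: serendipity_def)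

lemma serendipity_unisolvent:
  fixes c :: "('n::{finite,linorder} \<Rightarrow> nat) \<times> ('n \<Rightarrow> nat) \<Rightarrow> real"
  shows "\<exists>p\<in>serendipity r. \<forall>\<nu>\<in>dofs r. dof \<nu> p = c \<nu>"
    and "p \<in> serendipity r \<Longrightarrow> (\<And>\<nu> :: ('n \<Rightarrow> nat) \<times> ('n \<Rightarrow> nat). \<nu> \<in> dofs r \<Longrightarrow> dof \<nu> p = 0) \<Longrightarrow> p = 0"
proof -
  define \<psi> :: "('n \<Rightarrow> nat) \<times> ('n \<Rightarrow> nat) \<Rightarrow> real ^ 'n::{finite,linorder} \<Rightarrow> real"
    where "\<psi> = (\<lambda>\<nu>. poly_product (\<lambda>j. hier (dof_index \<nu> j)))"
  have img: "\<psi> ` dofs r = (\<lambda>\<gamma>. poly_product (\<lambda>j. hier (\<gamma> j))) ` superlinear_indices r"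
    unfolding \<psi>_def dof_index_image[symmetric] image_image ..
  then have sp: "span (\<psi> ` dofs r) = serendipity r" by (simp add: serendipity_eq_span_hier)
  have fin: "finite (dofs r :: (('n \<Rightarrow> nat) \<times> ('n \<Rightarrow> nat)) set)"
    by (intro finite_SigmaI finite_face_labels finite_face_derivs)
  \<comment> \<open>The rank is the total degree of the encoding. A componentwise inequality without
    a drop in total degree is an equality, and the encoding is injective.\<close>
  have tri: "\<kappa> = \<nu> \<or> multi_order (dof_index \<kappa>) < multi_order (dof_index \<nu>)"
    if "\<nu> \<in> dofs r" "\<kappa> \<in> dofs r" "dof \<nu> (\<psi> \<kappa>) \<noteq> 0" for \<nu> \<kappa>
  proof (rule disjCI)
    assume ge: "\<not> multi_order (dof_index \<kappa>) < multi_order (dof_index \<nu>)"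
    have le: "dof_index \<kappa> j \<le> dof_index \<nu> j" for j
      using dof_hier_triangular(1)[OF that(1)] that(3) by (simp add: \<psi>_def)
    have "dof_index \<kappa> j = dof_index \<nu> j" for j
    proof (rule ccontr)
      assume "dof_index \<kappa> j \<noteq> dof_index \<nu> j"
      then have "dof_index \<kappa> j < dof_index \<nu> j" using le[of j] by simp
      then have "multi_order (dof_index \<kappa>) < multi_order (dof_index \<nu>)"
        unfolding multi_order_def by (intro sum_strict_mono_ex1) (use le in auto)
      then show False using ge by simp
    qed
    then have "dof_index \<kappa> = dof_index \<nu>" by (rule ext)
    then show "\<kappa> = \<nu>" using inj_onD[OF inj_on_dof_index] that by blast
  qed
  have sub: "\<psi> ` dofs r \<subseteq> serendipity r" using span_superset[of "\<psi> ` dofs r"] sp by simp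
  have diag: "dof \<nu> (\<psi> \<nu>) \<noteq> 0" if "\<nu> \<in> dofs r" for \<nu>
    using dof_hier_triangular(2)[OF that] by (simp add: \<psi>_def)
  show "\<exists>p\<in>serendipity r. \<forall>\<nu>\<in>dofs r. dof \<nu> p = c \<nu>"
    unfolding sp[symmetric]
    by (rule triangular_system_solvable(1)[OF fin subspace_serendipity[of r]])
      (assumption | rule dof_linear_on_serendipity sub diag tri)+
  show "p = 0" if "p \<in> serendipity r"
    "\<And>\<nu> :: ('n \<Rightarrow> nat) \<times> ('n \<Rightarrow> nat). \<nu> \<in> dofs r \<Longrightarrow> dof \<nu> p = 0"
    using that(1) unfolding sp[symmetric]
    by (rule triangular_system_solvable(2)[OF fin subspace_serendipity[of r], rotated -2])
      (assumption | rule dof_linear_on_serendipity sub diag tri that(2))+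
qed

text \<open>The data \<open>c\<close> are arbitrary so that one statement covers both the
  interpolant of \<open>u\<close> and the nodal functions, whose data are Kronecker deltas.\<close>

lemma serendipity_ex1:
  fixes c :: "('n::{finite,linorder} \<Rightarrow> nat) \<times> ('n \<Rightarrow> nat) \<Rightarrow> real"
  shows "\<exists>!p. p \<in> serendipity r \<and> (\<forall>\<nu>\<in>dofs r. dof \<nu> p = c \<nu>)"
proof (rule ex_ex1I)
  show "\<exists>p. p \<in> serendipity r \<and> (\<forall>\<nu>\<in>dofs r. dof \<nu> p = c \<nu>)"
    using serendipity_unisolvent(1) by blast
  fix p q
  assume pq: "p \<in> serendipity r \<and> (\<forall>\<nu>\<in>dofs r. dof \<nu> p = c \<nu>)"
    "q \<in> serendipity r \<and> (\<forall>\<nu>\<in>dofs r. dof \<nu> q = c \<nu>)"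
  have "p - q = 0"
    using pq
    by (intro serendipity_unisolvent(2)[of _ r] subspace_diff[OF subspace_serendipity])
      (auto simp: linear_map_on_diff[OF dof_linear_on_serendipity subspace_serendipity, of p r q])
  then show "p = q" by simp
qed

section \<open>The interpolant and the nodal basis\<close>

lemma interpolates_iff_dof: "interpolates r u p \<longleftrightarrow> (\<forall>\<nu>\<in>dofs r. dof \<nu> p = dof \<nu> u)"
  by (auto simp: interpolates_def dof_def)

lemma nodal_iff_dof:
  "nodal r \<beta> \<rho> f \<longleftrightarrow>
     f \<in> serendipity r \<and> (\<forall>\<nu>\<in>dofs r. dof \<nu> f = (if (\<beta>, \<rho>) = \<nu> then 1 else 0))"
  by (auto simp: nodal_def dof_def)

text \<open>The nodal functions enter as any family \<open>\<phi>\<close> meeting the nodal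
  conditions; the second conjunct shows that they exist and are unique. Injectivity is included so
  that the indexed family, not just its image, is a basis.\<close>

theorem mainTheorem2:
  fixes r :: nat
  assumes "r \<ge> 1"
  shows
    "(\<forall>u :: real ^ 'n::{finite,linorder} \<Rightarrow> real. C_class r u \<longrightarrow>
        (\<exists>!p. p \<in> serendipity r \<and> interpolates r u p)) \<and>
     (\<forall>\<beta> :: 'n \<Rightarrow> nat. \<beta> \<in> face_labels \<longrightarrow> (\<forall>\<rho>\<in>face_derivs r \<beta>. \<exists>!f. nodal r \<beta> \<rho> f)) \<and>
     (\<forall>\<phi> :: ('n \<Rightarrow> nat) \<Rightarrow> ('n \<Rightarrow> nat) \<Rightarrow> real ^ 'n::{finite,linorder} \<Rightarrow> real.
        (\<forall>\<beta>\<in>face_labels. \<forall>\<rho>\<in>face_derivs r \<beta>. nodal r \<beta> \<rho> (\<phi> \<beta> \<rho>)) \<longrightarrow>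
          inj_on (\<lambda>(\<beta>, \<rho>). \<phi> \<beta> \<rho>) (Sigma face_labels (face_derivs r)) \<and>
          independent ((\<lambda>(\<beta>, \<rho>). \<phi> \<beta> \<rho>) ` Sigma face_labels (face_derivs r)) \<and>
          span ((\<lambda>(\<beta>, \<rho>). \<phi> \<beta> \<rho>) ` Sigma face_labels (face_derivs r)) = serendipity r \<and>
          (\<forall>u p. C_class r u \<longrightarrow> p \<in> serendipity r \<longrightarrow> interpolates r u p \<longrightarrow>
             (\<forall>x. p x = (\<Sum>\<beta>\<in>face_labels. \<Sum>\<rho>\<in>face_derivs r \<beta>.
                           multi_deriv \<rho> u (midpt \<beta>) * \<phi> \<beta> \<rho> x))))"
proof (intro conjI allI impI ballI)
  fix u :: "real ^ 'n::{finite,linorder} \<Rightarrow> real"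
  show "\<exists>!p. p \<in> serendipity r \<and> interpolates r u p"
    unfolding interpolates_iff_dof by (rule serendipity_ex1)
next
  fix \<beta> \<rho> :: "'n \<Rightarrow> nat"
  show "\<exists>!f. nodal r \<beta> \<rho> f"
    unfolding nodal_iff_dof by (rule serendipity_ex1)
next
  fix \<phi> :: "('n \<Rightarrow> nat) \<Rightarrow> ('n \<Rightarrow> nat) \<Rightarrow> real ^ 'n::{finite,linorder} \<Rightarrow> real"
  assume \<phi>: "\<forall>\<beta>\<in>face_labels. \<forall>\<rho>\<in>face_derivs r \<beta>. nodal r \<beta> \<rho> (\<phi> \<beta> \<rho>)"
  let ?\<phi> = "\<lambda>(\<beta>, \<rho>). \<phi> \<beta> \<rho>"
  have fin: "finite (dofs r :: (('n \<Rightarrow> nat) \<times> ('n \<Rightarrow> nat)) set)"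
    by (intro finite_SigmaI finite_face_labels finite_face_derivs)
  have W: "?\<phi> \<nu> \<in> serendipity r" if "\<nu> \<in> dofs r" for \<nu>
    using \<phi> that by (auto simp: nodal_iff_dof)
  have dual: "dof \<kappa> (?\<phi> \<nu>) = (if \<nu> = \<kappa> then 1 else 0)" if "\<nu> \<in> dofs r" "\<kappa> \<in> dofs r" for \<nu> \<kappa>
    using \<phi> that by (auto simp: nodal_iff_dof split: if_splits)
  have zero: "p = 0" if "p \<in> serendipity r" "\<And>\<nu>. \<nu> \<in> dofs r \<Longrightarrow> dof \<nu> p = 0"
    for p :: "real ^ 'n::{finite,linorder} \<Rightarrow> real"
    using that by (rule serendipity_unisolvent(2))
  \<comment> \<open>The nodal conditions say that \<open>\<phi>\<close> is dual to
    \<open>dof\<close>; unisolvence supplies the separation of points.\<close>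
  note basis = dual_family_basis[where L = dof and \<phi> = ?\<phi>, OF fin subspace_serendipity
      dof_linear_on_serendipity zero W dual]
  show "inj_on ?\<phi> (dofs r)" by (rule basis(1))
  show "independent (?\<phi> ` dofs r)" by (rule basis(2))
  show "span (?\<phi> ` dofs r) = serendipity r" by (rule basis(3))
  fix u p :: "real ^ 'n::{finite,linorder} \<Rightarrow> real" and x
  assume p: "p \<in> serendipity r" and "interpolates r u p"
  then have eq: "\<forall>\<nu>\<in>dofs r. dof \<nu> p = dof \<nu> u" by (simp only: interpolates_iff_dof)
  \<comment> \<open>The expansion uses the data of \<open>p\<close> itself, which interpolation then
    replaces by those of \<open>u\<close>.\<close>
  have "p = (\<Sum>\<nu>\<in>dofs r. dof \<nu> p *\<^sub>R ?\<phi> \<nu>)" by (rule basis(4)[OF _ _ _ _ _ p])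
  then have "p x = (\<Sum>\<nu>\<in>dofs r. dof \<nu> p *\<^sub>R ?\<phi> \<nu>) x" by (rule fun_cong)
  also have "\<dots> = (\<Sum>\<nu>\<in>dofs r. dof \<nu> u * ?\<phi> \<nu> x)"
    using eq by (auto simp: sum_fun_apply scaleR_fun_apply intro!: sum.cong)
  also have "\<dots> = (\<Sum>(\<beta>, \<rho>)\<in>dofs r. multi_deriv \<rho> u (midpt \<beta>) * \<phi> \<beta> \<rho> x)"
    by (auto simp: dof_def intro!: sum.cong)
  also have "\<dots> = (\<Sum>\<beta>\<in>face_labels. \<Sum>\<rho>\<in>face_derivs r \<beta>. multi_deriv \<rho> u (midpt \<beta>) * \<phi> \<beta> \<rho> x)"
    by (rule sum.Sigma[symmetric]) (simp_all add: finite_face_labels finite_face_derivs)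
  finally show "p x = (\<Sum>\<beta>\<in>face_labels. \<Sum>\<rho>\<in>face_derivs r \<beta>.
      multi_deriv \<rho> u (midpt \<beta>) * \<phi> \<beta> \<rho> x)" .
qed

end
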